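(* There is $k_0$ such that for every $k\ge k_0$ the following holds. Let $G$ be a finite graph with chromatic number $\chi(G)=k$, and let $H_1,\dots,H_r$ be bicliques (complete bipartite subgraphs of $G$) whose union covers every edge of $G$. Then $$\sum_{i=1}^r |V(H_i)| \ \ge\ k\log_2 k - k\log_2\log_2 k - k\log_2\log_2\log_2 k.$$
   Context: A biclique is a complete bipartite graph $(A,B)$; its order $|V(H)|=|A|+|B|$ is its number of vertices. The bicliques need not be edge-disjoint. All logarithms are to base 2. *)

theory Defs
  imports Complex_Main "Graph_Theory.Graph_Theory"
begin

text \<open>
  Finite simple graphs are rendered by the library locale \<open>pair_graph\<close>: finite, loop-free digraphs
  without parallel arcs whose arc relation is symmetric, so that an edge \<open>uv\<close> is represented by the
  two arcs \<open>(u,v)\<close> and \<open>(v,u)\<close>.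
  Every finite graph is isomorphic to one whose vertices are natural numbers, so a threshold for the
  vertex type \<open>nat\<close> is a threshold for all finite graphs.
\<close>

definition proper_colouring :: "('a, 'b) pre_digraph \<Rightarrow> nat \<Rightarrow> ('a \<Rightarrow> nat) \<Rightarrow> bool" where
  "proper_colouring G n c \<longleftrightarrow>
     (\<forall>v \<in> verts G. c v < n) \<and> (\<forall>(u, v) \<in> arcs_ends G. c u \<noteq> c v)"

definition chromatic_number :: "('a, 'b) pre_digraph \<Rightarrow> nat" where
  "chromatic_number G = (LEAST n. \<exists>c. proper_colouring G n c)"

text \<open>
  For finite loop-free digraphs the minimum is taken over a nonempty set, so it is attained.
\<close>

lemma (in digraph) proper_colouring_chromatic_number:
  "\<exists>c. proper_colouring G (chromatic_number G) c"
proof -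
  obtain c :: "'a \<Rightarrow> nat" where inj: "inj_on c (verts G)"
    and img: "c ` verts G = {i. i < card (verts G)}"
    using finite_imp_nat_seg_image_inj_on[OF finite_verts] finite_verts
    by (metis finite_imp_inj_to_nat_seg card_image card_Collect_less_nat)
  have "proper_colouring G (card (verts G)) c"
    unfolding proper_colouring_def
  proof (intro conjI ballI)
    fix v assume "v \<in> verts G"
    then show "c v < card (verts G)" using img by blast
  next
    fix e assume "e \<in> arcs_ends G"
    then obtain a where "a \<in> arcs G" "e = (tail G a, head G a)"
      by (auto simp: arcs_ends_conv)
    then show "case e of (u, v) \<Rightarrow> c u \<noteq> c v"
      using inj no_loops by (auto dest: inj_onD)
  qed
  then have "\<exists>n c. proper_colouring G n c" by blast
  then show ?thesis unfolding chromatic_number_def by (rule LeastI_ex)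
qed

text \<open>
  In \<open>complete_bipartite_digraph m n H\<close> the numbers \<open>m\<close> and \<open>n\<close> are the cardinalities of the two
  sides. An empty side is allowed; such a biclique has no edges.
\<close>

definition biclique :: "('a, 'b) pre_digraph \<Rightarrow> bool" where
  "biclique H \<longleftrightarrow> (\<exists>m n. complete_bipartite_digraph m n H)"

lemma biclique_with_proj_iff:
  "biclique (with_proj H) \<longleftrightarrow> finite (pverts H) \<and>
     (\<exists>A B. pverts H = A \<union> B \<and> A \<inter> B = {} \<and> parcs H = A \<times> B \<union> B \<times> A)"
  unfolding biclique_def complete_bipartite_digraph_pair_def by blast

end

theory Submission
  imports Defs
begin

text \<open>
  Write \<open>d v\<close> for the number of bicliques through \<open>v\<close>. Deleting a uniformly random side of each biclique
  leaves an independent set that contains \<open>v\<close> with probability \<open>2 powr - d v\<close>. After \<open>m\<close> such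
  independent sets have been used as colour classes, the remaining vertices get private colours, so
  \<open>k \<le> m + (\<Sum>v. (1 - 2 powr - d v) ^ m)\<close>. For \<open>m = \<lfloor>k / log 2 k\<rfloor>\<close> each summand is at most
  \<open>d v / (log 2 k - log 2 (log 2 k))\<close>, which turns this into a lower bound on the sum of all \<open>d v\<close>,
  that is, on the sum of the orders of the bicliques.
\<close>

text \<open>Method of conditional expectations: the left-hand sum is the expected weight left after
  deleting a random side of each biclique. The sides are fixed one biclique at a time, always
  deleting the one whose removal leaves the larger expectation; \<open>U\<close> shrinks on the way
  and is therefore generalised.\<close>

lemma exists_heavy_side_avoiding_subset:
  fixes w :: "'a \<Rightarrow> real" and A B :: "'i \<Rightarrow> 'a set"
  assumes "finite J" "finite U" "\<And>i. i \<in> J \<Longrightarrow> A i \<inter> B i = {}"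
  shows "\<exists>I \<subseteq> U. (\<forall>i \<in> J. I \<inter> A i = {} \<or> I \<inter> B i = {}) \<and>
           (\<Sum>v\<in>U. w v * (1/2) ^ card {i \<in> J. v \<in> A i \<union> B i}) \<le> sum w I"
  using assms
proof (induction J arbitrary: U rule: finite_induct)
  case empty
  then show ?case by auto
next
  case (insert j J)
  define g where "g v = w v * (1/2) ^ card {i \<in> J. v \<in> A i \<union> B i}" for v
  define h where "h v = w v * (1/2) ^ card {i \<in> insert j J. v \<in> A i \<union> B i}" for v
  have h: "h v = (if v \<in> A j \<union> B j then g v / 2 else g v)" for v
  proof -
    have "{i \<in> insert j J. v \<in> A i \<union> B i} =
        (if v \<in> A j \<union> B j then insert j {i \<in> J. v \<in> A i \<union> B i} else {i \<in> J. v \<in> A i \<union> B i})"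
      by auto
    then show ?thesis using insert.hyps by (simp add: g_def h_def)
  qed
  have dj: "A j \<inter> B j = {}" using insert.prems by auto
  \<comment> \<open>By disjointness of the sides, a vertex of biclique \<open>j\<close> survives
    exactly one of the two possible deletions; any other vertex survives both.\<close>
  have "2 * sum h U = (\<Sum>v\<in>U. (if v \<in> A j then 0 else g v) + (if v \<in> B j then 0 else g v))"
    unfolding sum_distrib_left by (rule sum.cong) (use dj in \<open>auto simp: h\<close>)
  also have "\<dots> = sum g (U - A j) + sum g (U - B j)"
    unfolding sum.distrib using insert.prems(1) by (simp add: sum.If_cases Diff_eq)
  finally have "sum h U \<le> sum g (U - A j) \<or> sum h U \<le> sum g (U - B j)" by linarith
  then obtain C where C: "C = A j \<or> C = B j" "sum h U \<le> sum g (U - C)" by blast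
  obtain I where "I \<subseteq> U - C" "\<forall>i \<in> J. I \<inter> A i = {} \<or> I \<inter> B i = {}" "sum g (U - C) \<le> sum w I"
    using insert.IH[of "U - C"] insert.prems unfolding g_def by auto
  with C show ?case unfolding h_def by (intro exI[of _ I]) auto
qed

text \<open>The sum is the expected number of vertices missed by \<open>m\<close> independent random
  rounds. Each induction step fixes one round, so no probability space is needed.\<close>

lemma exists_colouring_of_biclique_cover:
  fixes A B :: "'i \<Rightarrow> 'a set" and E :: "('a \<times> 'a) set"
  assumes J: "finite J" and disj: "\<And>i. i \<in> J \<Longrightarrow> A i \<inter> B i = {}"
    and cover: "E \<subseteq> (\<Union>i\<in>J. A i \<times> B i \<union> B i \<times> A i)"
    and "finite U"
  shows "\<exists>(c :: 'a \<Rightarrow> nat) n. (\<forall>v\<in>U. c v < n) \<and> (\<forall>u\<in>U. \<forall>v\<in>U. (u, v) \<in> E \<longrightarrow> c u \<noteq> c v) \<and>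
    real n \<le> real m + (\<Sum>v\<in>U. (1 - (1/2) ^ card {i \<in> J. v \<in> A i \<union> B i}) ^ m)"
  using \<open>finite U\<close>
proof (induction m arbitrary: U)
  case 0
  \<comment> \<open>With no rounds every vertex gets a private colour, and the sum of zeroth powers
    is \<open>card U\<close>.\<close>
  obtain c :: "'a \<Rightarrow> nat" where inj: "inj_on c U" and img: "c ` U = {i. i < card U}"
    using finite_imp_inj_to_nat_seg[OF 0] by (metis card_image card_Collect_less_nat)
  have "u \<noteq> v" if "(u, v) \<in> E" for u v using that cover disj by blast
  then show ?case using inj img
    by (intro exI[of _ c] exI[of _ "card U"]) (auto dest: inj_onD)
next
  case (Suc m)
  define q :: "'a \<Rightarrow> real" where "q v = (1/2) ^ card {i \<in> J. v \<in> A i \<union> B i}" for v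
  \<comment> \<open>The weight \<open>(1 - q v) ^ m\<close> is what \<open>v\<close> will contribute
    if it stays for the remaining \<open>m\<close> rounds, hence what is saved by putting it into
    the colour class \<open>I\<close> now.\<close>
  have "\<exists>I \<subseteq> U. (\<forall>i \<in> J. I \<inter> A i = {} \<or> I \<inter> B i = {}) \<and>
      (\<Sum>v\<in>U. (1 - q v) ^ m * q v) \<le> (\<Sum>v\<in>I. (1 - q v) ^ m)"
    unfolding q_def by (rule exists_heavy_side_avoiding_subset[OF J Suc.prems disj])
  then obtain I where I: "I \<subseteq> U" "\<forall>i \<in> J. I \<inter> A i = {} \<or> I \<inter> B i = {}"
      "(\<Sum>v\<in>U. (1 - q v) ^ m * q v) \<le> (\<Sum>v\<in>I. (1 - q v) ^ m)"
    by blast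
  obtain c n where c: "\<forall>v\<in>U - I. c v < n" "\<forall>u\<in>U - I. \<forall>v\<in>U - I. (u, v) \<in> E \<longrightarrow> c u \<noteq> (c v :: nat)"
      "real n \<le> real m + (\<Sum>v\<in>U - I. (1 - q v) ^ m)"
    using Suc.IH[of "U - I"] Suc.prems unfolding q_def by auto
  have indep: "(u, v) \<notin> E" if "u \<in> I" "v \<in> I" for u v
    using that I(2) cover by fast
  have "(\<Sum>v\<in>U - I. (1 - q v) ^ m) = (\<Sum>v\<in>U. (1 - q v) ^ m) - (\<Sum>v\<in>I. (1 - q v) ^ m)"
    using I(1) Suc.prems by (simp add: sum_diff)
  also have "\<dots> \<le> (\<Sum>v\<in>U. (1 - q v) ^ m) - (\<Sum>v\<in>U. (1 - q v) ^ m * q v)"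
    using I(3) by simp
  also have "\<dots> = (\<Sum>v\<in>U. (1 - q v) ^ Suc m)"
    by (simp add: algebra_simps flip: sum_subtractf)
  finally have le: "real (Suc n) \<le> real (Suc m) + (\<Sum>v\<in>U. (1 - q v) ^ Suc m)"
    using c(3) by simp
  define c' where "c' v = (if v \<in> I then n else c v)" for v
  have "\<forall>v\<in>U. c' v < Suc n" using c(1) by (auto simp: c'_def intro: less_SucI)
  moreover have "\<forall>u\<in>U. \<forall>v\<in>U. (u, v) \<in> E \<longrightarrow> c' u \<noteq> c' v"
    using c(1,2) indep by (auto simp: c'_def)
  ultimately show ?case using le unfolding q_def by blast
qed

text \<open>The line \<open>(1 + t) / 2\<close> separates the two sides: the tangent of
  \<open>ln\<close> at 2 lies below it, and \<open>exp z \<ge> 1 + z\<close> puts the right-hand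
  side above it. The slack 1/2 later pays for rounding \<open>y\<close> down.\<close>

lemma ln_1_plus_le_powr:
  fixes t :: real
  assumes "0 \<le> t"
  shows "ln (1 + t) \<le> 2 powr t - 1/2"
proof -
  have l2: "1/2 \<le> ln (2::real)" "ln (2::real) \<le> 1"
    using ln_ge_iff[of 2 "1/2"] exp_bound_half[of "1/2::real"] ln_le_minus_one[of 2] by auto
  have "ln (1 + t) = ln 2 + ln ((1 + t) / 2)"
    using assms by (simp add: ln_div)
  also have "\<dots> \<le> ln 2 + ((1 + t) / 2 - 1)"
    using assms ln_le_minus_one[of "(1 + t) / 2"] by simp
  also have "\<dots> \<le> 1/2 + t * (1/2)" using l2 by (simp add: field_simps)
  also have "\<dots> \<le> 1/2 + t * ln 2" using l2(1) assms by (intro add_left_mono mult_left_mono)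
  also have "\<dots> \<le> 2 powr t - 1/2"
    using exp_ge_add_one_self[of "t * ln 2"] by (simp add: powr_def)
  finally show ?thesis .
qed

text \<open>A bound linear in \<open>d\<close> can be summed over the vertices. The critical range
  is \<open>1 \<le> d < log 2 y\<close>, where \<open>(1 - p) ^ m \<le> exp (- m * p)\<close>
  reduces the claim to the previous inequality.\<close>

lemma log_mult_miss_probability_le:
  fixes y :: real and d :: nat
  assumes y: "1 \<le> y"
  shows "log 2 y * (1 - (1/2) ^ d) ^ nat \<lfloor>y\<rfloor> \<le> real d"
proof -
  let ?L = "log 2 y" and ?m = "nat \<lfloor>y\<rfloor>"
  have L0: "0 \<le> ?L" using y by simp
  have m: "y - 1 \<le> real ?m" "?m \<noteq> 0" using y by linarith+
  have p: "0 \<le> 1 - (1/2::real) ^ d" "1 - (1/2::real) ^ d \<le> 1" by (auto simp: power_le_one)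
  consider "d = 0" | "?L \<le> d" | "1 \<le> d" "d < ?L" by linarith
  then show ?thesis
  proof cases
    case 1
    \<comment> \<open>A vertex in no biclique is never missed; since \<open>0 ^ 0 = 1\<close>, this
      needs at least one round.\<close>
    then show ?thesis using m(2) by (simp only: power_0 diff_self power_0_left) simp
  next
    case 2
    have "?L * (1 - (1/2) ^ d) ^ ?m \<le> ?L"
      using L0 p by (simp add: mult_left_le power_le_one)
    with 2 show ?thesis by linarith
  next
    case 3
    define t where "t = ?L - d"
    have t: "0 < t" using 3 by (simp add: t_def)
    have half: "(1/2::real) ^ d \<le> 1/2" using 3(1) by (cases d) (auto simp: power_le_one)
    \<comment> \<open>This is the expected number of hits of a vertex in \<open>y\<close> unrounded
      rounds. Rounding down loses at most \<open>(1/2) ^ d\<close>, which is at most 1/2 as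
      \<open>d \<ge> 1\<close>.\<close>
    have "2 powr t = y * (1/2) ^ d"
      using y by (simp add: t_def powr_diff powr_realpow power_divide)
    then have e: "2 powr t - 1/2 \<le> real ?m * (1/2) ^ d"
      using mult_right_mono[OF m(1), of "(1/2) ^ d"] half by (simp add: algebra_simps)
    have "?L / d = 1 + t / d" using 3(1) by (simp add: t_def field_simps)
    also have "\<dots> \<le> 1 + t" using t 3(1) by (simp add: divide_le_eq)
    finally have "?L / d \<le> 1 + t" .
    also have "\<dots> = exp (ln (1 + t))" using t by simp
    also have "\<dots> \<le> exp (real ?m * (1/2) ^ d)" using ln_1_plus_le_powr[of t] t e by (subst exp_le_cancel_iff) linarith
    finally have L: "?L \<le> d * exp (real ?m * (1/2) ^ d)" using 3(1) by (simp add: field_simps)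
    have "(1 - (1/2::real) ^ d) ^ ?m \<le> exp (- ((1/2) ^ d)) ^ ?m"
      using p exp_ge_add_one_self[of "- ((1/2::real) ^ d)"] by (intro power_mono) auto
    also have "\<dots> = exp (- (real ?m * (1/2) ^ d))" by (simp flip: exp_of_nat_mult)
    finally have "?L * (1 - (1/2) ^ d) ^ ?m \<le> ?L * exp (- (real ?m * (1/2) ^ d))"
      using L0 by (rule mult_left_mono)
    also have "\<dots> \<le> d" using L by (simp add: exp_minus field_simps)
    finally show ?thesis .
  qed
qed

text \<open>The threshold is 16 = 2^(2^2), where the triple logarithm reaches 1.\<close>

lemma iterated_log_bounds:
  fixes k :: nat
  assumes "16 \<le> k"
  shows "4 \<le> log 2 (real k)" "1 \<le> real k / log 2 (real k)"
    "1 \<le> log 2 (log 2 (log 2 (real k)))" "0 \<le> log 2 (log 2 (real k))"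
proof -
  show x: "4 \<le> log 2 (real k)" using assms by (simp add: le_log_iff)
  then have lx: "2 \<le> log 2 (log 2 (real k))" by (simp add: le_log_iff)
  then show "1 \<le> log 2 (log 2 (log 2 (real k)))" "0 \<le> log 2 (log 2 (real k))"
    by (simp_all add: le_log_iff)
  have "real k < 2 ^ k" by (rule of_nat_less_two_power)
  then have "log 2 (real k) \<le> k" using assms by (simp add: log_le_iff powr_realpow)
  then show "1 \<le> real k / log 2 (real k)" using x by (simp add: le_divide_eq)
qed

lemma sum_card_eq_sum_multiplicity:
  assumes "finite V" "finite J" "\<And>i. i \<in> J \<Longrightarrow> S i \<subseteq> V"
  shows "(\<Sum>i\<in>J. card (S i)) = (\<Sum>v\<in>V. card {i \<in> J. v \<in> S i})"
proof -
  have "(\<Sum>i\<in>J. card (S i)) = (\<Sum>i\<in>J. card {v \<in> V. v \<in> S i})"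
    using assms(3) by (intro sum.cong refl arg_cong[where f = card]) auto
  also have "\<dots> = (\<Sum>v\<in>V. card {i \<in> J. v \<in> S i})"
    using assms(1,2) by (intro sum_multicount_gen[symmetric]) auto
  finally show ?thesis .
qed

lemma chromatic_number_le:
  "proper_colouring G n c \<Longrightarrow> chromatic_number G \<le> n"
  unfolding chromatic_number_def by (blast intro: Least_le)

lemma chromatic_number_biclique_cover_le:
  fixes G :: "'a pair_pre_digraph" and H :: "'i \<Rightarrow> 'a pair_pre_digraph"
  assumes "pair_graph G" "finite J"
    and H: "\<And>i. i \<in> J \<Longrightarrow> biclique (with_proj (H i))"
    and cover: "parcs G \<subseteq> (\<Union>i\<in>J. parcs (H i))"
  shows "real (chromatic_number (with_proj G)) \<le>
    real m + (\<Sum>v\<in>pverts G. (1 - (1/2) ^ card {i \<in> J. v \<in> pverts (H i)}) ^ m)"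
proof -
  interpret pair_graph G by fact
  obtain A B where AB: "\<And>i. i \<in> J \<Longrightarrow> pverts (H i) = A i \<union> B i \<and> A i \<inter> B i = {} \<and>
      parcs (H i) = A i \<times> B i \<union> B i \<times> A i"
    using H unfolding biclique_with_proj_iff by metis
  have "parcs G \<subseteq> (\<Union>i\<in>J. A i \<times> B i \<union> B i \<times> A i)" using cover AB by auto
  then obtain c :: "'a \<Rightarrow> nat" and n
    where c: "\<forall>v\<in>pverts G. c v < n" "\<forall>u\<in>pverts G. \<forall>v\<in>pverts G. (u, v) \<in> parcs G \<longrightarrow> c u \<noteq> c v"
      and n: "real n \<le> real m + (\<Sum>v\<in>pverts G. (1 - (1/2) ^ card {i \<in> J. v \<in> A i \<union> B i}) ^ m)"
    using exists_colouring_of_biclique_cover[of J A B "parcs G" "pverts G" m] \<open>finite J\<close> AB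
    by auto
  have "proper_colouring (with_proj G) n c"
    using c in_arcsD1 in_arcsD2 by (auto simp: proper_colouring_def arcs_ends_conv)
  then have "real (chromatic_number (with_proj G)) \<le> n" by (simp add: chromatic_number_le)
  moreover have "{i \<in> J. v \<in> A i \<union> B i} = {i \<in> J. v \<in> pverts (H i)}" for v
    using AB by auto
  ultimately show ?thesis using n by simp
qed

theorem theorem2:
  shows "\<exists>k\<^sub>0 :: nat. \<forall>k \<ge> k\<^sub>0.
    \<forall>(G :: 'a pair_pre_digraph) (r :: nat) (H :: nat \<Rightarrow> 'a pair_pre_digraph).
      pair_graph G \<longrightarrow>
      chromatic_number (with_proj G) = k \<longrightarrow>
      (\<forall>i \<in> {1..r}. biclique (with_proj (H i)) \<and> subgraph (with_proj (H i)) (with_proj G)) \<longrightarrow>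
      parcs G \<subseteq> (\<Union>i \<in> {1..r}. parcs (H i)) \<longrightarrow>
      real (\<Sum>i = 1..r. card (pverts (H i))) \<ge>
        real k * log 2 (real k) - real k * log 2 (log 2 (real k))
          - real k * log 2 (log 2 (log 2 (real k)))"
proof (intro exI[of _ 16] allI impI)
  fix k :: nat and G :: "'a pair_pre_digraph" and r and H :: "nat \<Rightarrow> 'a pair_pre_digraph"
  assume k: "16 \<le> k" and G: "pair_graph G" and \<chi>: "chromatic_number (with_proj G) = k"
    and H: "\<forall>i \<in> {1..r}. biclique (with_proj (H i)) \<and> subgraph (with_proj (H i)) (with_proj G)"
    and cover: "parcs G \<subseteq> (\<Union>i \<in> {1..r}. parcs (H i))"
  interpret pair_graph G by fact
  define x where "x = log 2 (real k)"
  define y where "y = real k / x"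
  \<comment> \<open>With about \<open>k / x\<close> rounds, the colours spent on them cost at most
    \<open>k\<close> in the final bound, because \<open>log 2 y \<le> x\<close>.\<close>
  define m where "m = nat \<lfloor>y\<rfloor>"
  define d where "d v = card {i \<in> {1..r}. v \<in> pverts (H i)}" for v
  note b = iterated_log_bounds[OF k, folded x_def, folded y_def]
  have L: "log 2 y = x - log 2 x" using b(1) k by (simp add: y_def x_def log_divide)
  have L0: "0 \<le> log 2 y" using b(2) by simp
  have "real k \<le> real m + (\<Sum>v\<in>pverts G. (1 - (1/2) ^ d v) ^ m)"
    using chromatic_number_biclique_cover_le[OF G, of "{1..r}" H m] H cover \<chi>
    by (auto simp: d_def)
  moreover have "real m \<le> y" using b(2) by (simp add: m_def)
  ultimately have "real k - y \<le> (\<Sum>v\<in>pverts G. (1 - (1/2) ^ d v) ^ m)" by linarith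
  then have "log 2 y * (real k - y) \<le> (\<Sum>v\<in>pverts G. log 2 y * (1 - (1/2) ^ d v) ^ m)"
    using L0 by (simp add: mult_left_mono flip: sum_distrib_left)
  also have "\<dots> \<le> (\<Sum>v\<in>pverts G. real (d v))"
    unfolding m_def by (intro sum_mono log_mult_miss_probability_le b)
  \<comment> \<open>Double counting of incidences; being subgraphs, the bicliques have all their
    vertices in \<open>G\<close>.\<close>
  also have "\<dots> = real (\<Sum>i = 1..r. card (pverts (H i)))"
    using sum_card_eq_sum_multiplicity[of "pverts G" "{1..r}" "\<lambda>i. pverts (H i)"] H
    by (auto simp: d_def subgraph_def simp flip: of_nat_sum)
  finally have main: "log 2 y * (real k - y) \<le> real (\<Sum>i = 1..r. card (pverts (H i)))" .
  \<comment> \<open>The product below expands with an error of \<open>-1 + log 2 x / x\<close> per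
    unit of \<open>k\<close>. The triple logarithm, being at least 1, absorbs it.\<close>
  have "0 \<le> log 2 x / x" using b by simp
  then have ge: "x - log 2 x - log 2 (log 2 x) \<le> x - log 2 x - 1 + log 2 x / x"
    using b(3) by linarith
  have "log 2 y * (real k - y) = real k * (x - log 2 x - 1 + log 2 x / x)"
    using b(1) unfolding L by (simp add: y_def field_simps)
  also have "\<dots> \<ge> real k * (x - log 2 x - log 2 (log 2 x))"
    using ge by (rule mult_left_mono) simp
  finally show "real (\<Sum>i = 1..r. card (pverts (H i))) \<ge>
      real k * log 2 (real k) - real k * log 2 (log 2 (real k))
        - real k * log 2 (log 2 (log 2 (real k)))"
    using main by (simp add: x_def algebra_simps)
qed

end
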